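(* The pair $(\mathbb{R},\mathbb{R})$ fails the maximal uniform approximation by affine property. That is, there exists $\varepsilon>0$ such that for every $0<c<1$, there are an interval $I\subseteq\mathbb{R}$ and a nonzero $f\in \mathrm{Lip}(I,\mathbb{R})$ such that whenever $I_1\subseteq I$ is an interval with $\mathrm{diam}(I_1)\ge c\,\mathrm{diam}(I)$ and $g:I_1\to\mathbb{R}$ is an affine function such that $\mathrm{Lip}(g)>\mathrm{Lip}(f|_I)-\varepsilon$, we have $$\sup_{t\in I_1}|g(t)-f(t)| \ge \varepsilon\,\mathrm{diam}(I_1)\,\mathrm{Lip}(f).$$
   Context: For a map $f$ defined on a subset $A$ of a Banach space, its Lipschitz number is $\mathrm{Lip}(f)=\sup\{\|f(p)-f(q)\|/\|p-q\| : p,q\in A,\ p\neq q\}$; $\mathrm{Lip}(X,Y)$ (resp. $\mathrm{Lip}(I,\mathbb{R})$) denotes the set of Lipschitz maps from $X$ to $Y$ (resp. from the interval $I$ to $\mathbb{R}$). Intervals here are bounded and nondegenerate (balls of $\mathbb{R}$), and $\mathrm{diam}$ denotes diameter. A pair $(X,Y)$ of Banach spaces has the maximal uniform approximation by affine property (maximal uniform AAP) if for every $\varepsilon>0$ there is $c=c(\varepsilon)>0$ such that for every Lipschitz map $f\in \mathrm{Lip}(X,Y)$ and every ball $B\subseteq X$, there exist a ball $B_1\subseteq B$ with $\mathrm{diam}(B_1)\ge c\,\mathrm{diam}(B)$ and an affine function $g:B_1\to Y$ such that $$\mathrm{Lip}(g) > \mathrm{Lip}(f|_B)-\varepsilon \quad\text{and}\quad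 \sup_{x\in B_1}\|g(x)-f(x)\| \le \varepsilon\,\mathrm{diam}(B_1)\,\mathrm{Lip}(f).$$ *)

theory Defs
  imports "HOL-Analysis.Analysis" "HOL-Library.Extended_Real"
begin

text \<open>The inserted 0 only matters when A has at most one point (the supremum is taken in
  \<open>[0, \<infinity>]\<close>). The value is extended real because nothing bounds the quotients a priori,
  and because differences such as \<open>Lip B f - \<epsilon>\<close> may be negative.\<close>

definition Lip :: "'a::real_normed_vector set \<Rightarrow> ('a \<Rightarrow> 'b::real_normed_vector) \<Rightarrow> ereal" where
  "Lip A f = Sup (insert 0
     {ereal (norm (f p - f q) / norm (p - q)) | p q. p \<in> A \<and> q \<in> A \<and> p \<noteq> q})"

definition is_ball :: "'a::metric_space set \<Rightarrow> bool" where
  "is_ball B \<longleftrightarrow> (\<exists>x r. 0 < r \<and> (B = ball x r \<or> B = cball x r))"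

text \<open>Used for convex S. Continuity is not required.\<close>

definition affine_map_on :: "'a::real_vector set \<Rightarrow> ('a \<Rightarrow> 'b::real_vector) \<Rightarrow> bool" where
  "affine_map_on S g \<longleftrightarrow> (\<forall>x\<in>S. \<forall>y\<in>S. \<forall>t\<in>{0..1}.
     g ((1 - t) *\<^sub>R x + t *\<^sub>R y) = (1 - t) *\<^sub>R g x + t *\<^sub>R g y)"

text \<open>Maps on a subset are represented by total functions of which only the values on that
  subset are used; so f is a map on the whole space and g a map on \<open>B1\<close>.\<close>

definition maximal_uniform_AAP :: "'a::banach itself \<Rightarrow> 'b::banach itself \<Rightarrow> bool" where
  "maximal_uniform_AAP X Y \<longleftrightarrow>
    (\<forall>\<epsilon>::real. \<epsilon> > 0 \<longrightarrow> (\<exists>c::real. c > 0 \<and>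
      (\<forall>(f :: 'a \<Rightarrow> 'b) B. (\<exists>C. C-lipschitz_on UNIV f) \<longrightarrow> is_ball B \<longrightarrow>
        (\<exists>B1 g. is_ball B1 \<and> B1 \<subseteq> B \<and> diameter B1 \<ge> c * diameter B \<and>
          affine_map_on B1 g \<and>
          Lip B1 g > Lip B f - ereal \<epsilon> \<and>
          (SUP x\<in>B1. ereal (norm (g x - f x))) \<le> ereal (\<epsilon> * diameter B1) * Lip UNIV f))))"

definition bounded_interval :: "real set \<Rightarrow> bool" where
  "bounded_interval I \<longleftrightarrow> is_interval I \<and> bounded I \<and> interior I \<noteq> {}"

end

theory Submission
  imports Defs
begin

text \<open>The function \<open>t \<mapsto> min \<bar>t\<bar> \<delta>\<close> has Lipschitz number 1 on the unit interval but is bounded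
  by \<open>\<delta>\<close>. An affine function of slope greater than 3/4 oscillates by at least \<open>3d/4\<close> on an
  interval of length \<open>d\<close>, so once \<open>\<delta>\<close> is small compared with \<open>d\<close> it stays away from this function
  by a fixed proportion of \<open>d\<close>.\<close>

lemma Lip_upper:
  assumes "p \<in> A" "q \<in> A" "p \<noteq> q"
  shows "ereal (norm (f p - f q) / norm (p - q)) \<le> Lip A f"
  unfolding Lip_def using assms by (intro Sup_upper) blast

lemma Lip_le_lipschitz_const:
  assumes "C-lipschitz_on A f"
  shows "Lip A f \<le> ereal C"
  unfolding Lip_def
proof (rule Sup_least)
  fix z
  assume "z \<in> insert 0 {ereal (norm (f p - f q) / norm (p - q)) | p q. p \<in> A \<and> q \<in> A \<and> p \<noteq> q}"
  then consider "z = 0"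
    | p q where "z = ereal (norm (f p - f q) / norm (p - q))" "p \<in> A" "q \<in> A" "p \<noteq> q"
    by blast
  then show "z \<le> ereal C"
  proof cases
    case 1
    then show ?thesis using lipschitz_on_nonneg[OF assms] by simp
  next
    case 2
    then show ?thesis
      using lipschitz_on_normD[OF assms, of p q] by (simp add: divide_le_eq)
  qed
qed

text \<open>Some element of the set under the supremum exceeds \<open>a\<close>; since
  \<open>0 \<le> a\<close>, it is not the inserted 0 and so must be a difference quotient.\<close>

lemma less_LipE:
  assumes "ereal a < Lip A f" "0 \<le> a"
  obtains p q where "p \<in> A" "q \<in> A" "p \<noteq> q" "a < norm (f p - f q) / norm (p - q)"
  using assms unfolding Lip_def less_Sup_iff by auto

lemma affine_map_on_chord:
  fixes g :: "real \<Rightarrow> real"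
  assumes "affine_map_on S g" "u \<in> S" "w \<in> S" "u < w" "z \<in> {u..w}"
  shows "g z = g u + (g w - g u) / (w - u) * (z - u)"
proof -
  define t where "t = (z - u) / (w - u)"
  have "t \<in> {0..1}" using assms(4,5) by (auto simp: t_def)
  then have "g ((1 - t) * u + t * w) = (1 - t) * g u + t * g w"
    using assms(1-3) unfolding affine_map_on_def by simp
  moreover have "t * (w - u) = z - u" using assms(4) by (simp add: t_def)
  then have "(1 - t) * u + t * w = z" by (simp add: algebra_simps)
  moreover have "(g w - g u) / (w - u) * (z - u) = t * (g w - g u)"
    by (simp add: t_def)
  ultimately show ?thesis by (simp add: algebra_simps)
qed

text \<open>The four points may come in any order, so the chord formula is applied between the
  smallest and the largest of them. Both lie in \<open>S\<close>, and the slope \<open>k\<close> of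
  that chord governs the increments of \<open>g\<close> between any two of the four.\<close>

lemma affine_map_on_slope_unique:
  fixes g :: "real \<Rightarrow> real"
  assumes "affine_map_on S g" "x \<in> S" "y \<in> S" "p \<in> S" "q \<in> S" "p \<noteq> q"
  shows "\<bar>g x - g y\<bar> = \<bar>g p - g q\<bar> / \<bar>p - q\<bar> * \<bar>x - y\<bar>"
proof -
  define T where "T = {x, y, p, q}"
  define u where "u = Min T"
  define w where "w = Max T"
  have fin: "finite T" "T \<noteq> {}" and T: "T \<subseteq> S" using assms by (auto simp: T_def)
  have uw: "u \<in> S" "w \<in> S"
    using Min_in[OF fin] Max_in[OF fin] T by (auto simp: u_def w_def)
  have bounds: "T \<subseteq> {u..w}" using fin by (auto simp: u_def w_def)
  then have "u < w" using \<open>p \<noteq> q\<close> by (auto simp: T_def)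
  define k where "k = (g w - g u) / (w - u)"
  have "g z = g u + k * (z - u)" if "z \<in> T" for z
    using affine_map_on_chord[OF assms(1) uw \<open>u < w\<close>] bounds that unfolding k_def by blast
  then have "g a - g b = k * (a - b)" if "a \<in> T" "b \<in> T" for a b
    using that by (simp add: right_diff_distrib)
  then have "\<bar>g a - g b\<bar> = \<bar>k\<bar> * \<bar>a - b\<bar>" if "a \<in> T" "b \<in> T" for a b
    using that by (simp add: abs_mult)
  then show ?thesis using \<open>p \<noteq> q\<close> by (simp add: T_def)
qed

text \<open>Write d for \<open>diameter S\<close>. If \<open>g\<close> were within s < d/4 of
  \<open>f\<close> on \<open>S\<close>, it would oscillate by at most 2s + 2\<delta>, while a slope
  above 3/4 makes it oscillate by at least 3/4 of any distance in \<open>S\<close>. Hence 3d \<le>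
  8s + 8\<delta> < 2d + d, which is absurd.\<close>

lemma steep_affine_far_from_small:
  fixes f g :: "real \<Rightarrow> real"
  assumes aff: "affine_map_on S g" and steep: "Lip S g > ereal (3/4)"
    and small: "\<And>x. x \<in> S \<Longrightarrow> \<bar>f x\<bar> \<le> \<delta>" and \<delta>: "8 * \<delta> \<le> diameter S"
  shows "ereal (diameter S / 4) \<le> (SUP t\<in>S. ereal \<bar>g t - f t\<bar>)"
proof (rule ccontr)
  assume "\<not> ?thesis"
  then have less: "(SUP t\<in>S. ereal \<bar>g t - f t\<bar>) < ereal (diameter S / 4)" by simp
  \<comment> \<open>A uniform bound strictly below d/4 is essential: pointwise strict inequalities
    become weak when passing to the diameter, and d \<le> d would be no contradiction.\<close>
  then obtain s where s: "(SUP t\<in>S. ereal \<bar>g t - f t\<bar>) < ereal s" "s < diameter S / 4"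
    using ereal_dense2[OF less] by auto
  have close: "\<bar>g t - f t\<bar> < s" if "t \<in> S" for t
  proof -
    have "ereal \<bar>g t - f t\<bar> \<le> (SUP t\<in>S. ereal \<bar>g t - f t\<bar>)"
      using that by (rule SUP_upper)
    also note s(1)
    finally show ?thesis by simp
  qed
  obtain p q where pq: "p \<in> S" "q \<in> S" "p \<noteq> q" "3/4 < \<bar>g p - g q\<bar> / \<bar>p - q\<bar>"
    using less_LipE[OF steep] by auto
  have dist: "norm (x - y) \<le> 4/3 * (2 * s + 2 * \<delta>)" if "x \<in> S" "y \<in> S" for x y
  proof -
    have "3/4 * \<bar>x - y\<bar> \<le> \<bar>g p - g q\<bar> / \<bar>p - q\<bar> * \<bar>x - y\<bar>"
      using pq(4) by (intro mult_right_mono) auto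
    also have "\<dots> = \<bar>g x - g y\<bar>"
      using affine_map_on_slope_unique[OF aff that pq(1-3)] by simp
    also have "\<dots> \<le> 2 * s + 2 * \<delta>"
      using close[OF that(1)] close[OF that(2)] small[OF that(1)] small[OF that(2)] by linarith
    finally show ?thesis by simp
  qed
  have "diameter S \<le> 4/3 * (2 * s + 2 * \<delta>)"
    using pq(1) dist by (intro diameter_le) auto
  then have "3 * diameter S \<le> 8 * s + 8 * \<delta>" by simp
  then show False using s(2) \<delta> by linarith
qed

lemma lipschitz_on_min_abs: "1-lipschitz_on A (\<lambda>t :: real. min \<bar>t\<bar> \<delta>)"
  by (rule lipschitz_onI) (auto simp: dist_real_def)

lemma Lip_min_abs:
  assumes "0 < \<delta>" "\<delta> \<le> 1" "{0..1} \<subseteq> A"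
  shows "Lip A (\<lambda>t :: real. min \<bar>t\<bar> \<delta>) = 1"
proof (rule antisym)
  show "Lip A (\<lambda>t. min \<bar>t\<bar> \<delta>) \<le> 1"
    using Lip_le_lipschitz_const[OF lipschitz_on_min_abs] by (simp add: one_ereal_def)
  \<comment> \<open>The pair 0, \<open>\<delta>\<close> lies on the rising part of the graph, so its
    difference quotient is exactly 1.\<close>
  have "0 \<in> A" "\<delta> \<in> A" using assms by auto
  from Lip_upper[OF this, of "\<lambda>t. min \<bar>t\<bar> \<delta>"] assms
  show "1 \<le> Lip A (\<lambda>t. min \<bar>t\<bar> \<delta>)" by (simp add: one_ereal_def)
qed

text \<open>The same function, now on the whole line, still has Lipschitz number 1. The property is
  refuted at 1/8: this is strictly below the proportion 1/4 by which a steep affine map must miss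
  \<open>f\<close>, and 1 - 1/8 still exceeds the slope threshold 3/4.\<close>

lemma not_maximal_uniform_AAP_real: "\<not> maximal_uniform_AAP TYPE(real) TYPE(real)"
proof
  assume "maximal_uniform_AAP TYPE(real) TYPE(real)"
  then obtain c :: real where c: "c > 0"
    and AAP: "\<And>(f :: real \<Rightarrow> real) B. (\<exists>C. C-lipschitz_on UNIV f) \<Longrightarrow> is_ball B \<Longrightarrow>
        (\<exists>B1 g. is_ball B1 \<and> B1 \<subseteq> B \<and> diameter B1 \<ge> c * diameter B \<and> affine_map_on B1 g \<and>
          Lip B1 g > Lip B f - ereal (1/8) \<and>
          (SUP x\<in>B1. ereal (norm (g x - f x))) \<le> ereal (1/8 * diameter B1) * Lip UNIV f)"
    unfolding maximal_uniform_AAP_def by (auto dest!: spec[of _ "1/8 :: real"])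
  \<comment> \<open>The constant \<open>c\<close> may exceed 1 here; the minimum keeps
    \<open>\<delta>\<close> inside the unit interval, where the slope 1 has to be visible.\<close>
  define \<delta> where "\<delta> = min c 1 / 8"
  define f where "f = (\<lambda>t :: real. min \<bar>t\<bar> \<delta>)"
  have \<delta>: "0 < \<delta>" "\<delta> \<le> 1" "8 * \<delta> \<le> c" using c by (auto simp: \<delta>_def)
  have unit: "is_ball {0..1::real}"
    unfolding is_ball_def by (rule exI[of _ "1/2"], rule exI[of _ "1/2"]) (simp add: cball_eq_atLeastAtMost)
  obtain B1 g where B1: "diameter B1 \<ge> c" "affine_map_on B1 g"
    "Lip B1 g > 1 - ereal (1/8)" "(SUP x\<in>B1. ereal \<bar>g x - f x\<bar>) \<le> ereal (1/8 * diameter B1)"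
    using AAP[of f "{0..1}"] unit lipschitz_on_min_abs[of UNIV \<delta>] Lip_min_abs[OF \<delta>(1,2)]
    by (auto simp: f_def)
  have "ereal (3/4) < Lip B1 g"
    by (rule less_trans[OF _ B1(3)]) (simp add: one_ereal_def)
  then have "ereal (diameter B1 / 4) \<le> (SUP x\<in>B1. ereal \<bar>g x - f x\<bar>)"
    using B1(1,2) \<delta> by (intro steep_affine_far_from_small[where \<delta> = \<delta>]) (auto simp: f_def)
  also note B1(4)
  \<comment> \<open>A quarter of the diameter is at most an eighth of it, although the diameter is
    at least \<open>c > 0\<close>.\<close>
  finally show False using B1(1) c by simp
qed

theorem theorem3p4:
  shows "\<not> maximal_uniform_AAP TYPE(real) TYPE(real) \<and>
    (\<exists>\<epsilon>::real. \<epsilon> > 0 \<and>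
      (\<forall>c::real. 0 < c \<and> c < 1 \<longrightarrow>
        (\<exists>I (f :: real \<Rightarrow> real). bounded_interval I \<and>
          (\<exists>C. C-lipschitz_on I f) \<and> (\<exists>t\<in>I. f t \<noteq> 0) \<and> Lip I f > 0 \<and>
          (\<forall>I1 (g :: real \<Rightarrow> real).
            bounded_interval I1 \<and> I1 \<subseteq> I \<and> diameter I1 \<ge> c * diameter I \<and>
            affine_map_on I1 g \<and> Lip I1 g > Lip I f - ereal \<epsilon> \<longrightarrow>
            (SUP t\<in>I1. ereal \<bar>g t - f t\<bar>) \<ge> ereal (\<epsilon> * diameter I1) * Lip I f))))"
proof (intro conjI exI[of _ "1/4 :: real"] allI impI)
  show "\<not> maximal_uniform_AAP TYPE(real) TYPE(real)"
    by (rule not_maximal_uniform_AAP_real)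
  \<comment> \<open>The value 1/4 serves both roles of \<epsilon>: 1 - 1/4 is the slope threshold
    3/4, and d/4 is the guaranteed error.\<close>
  show "(0::real) < 1/4" by simp
  fix c :: real
  assume c: "0 < c \<and> c < 1"
  \<comment> \<open>The unit interval has diameter 1, so every admissible \<open>I1\<close> has
    diameter at least \<open>c\<close>, which equals \<open>8 * \<delta>\<close>.\<close>
  define \<delta> where "\<delta> = c / 8"
  define f where "f = (\<lambda>t :: real. min \<bar>t\<bar> \<delta>)"
  have \<delta>: "0 < \<delta>" "\<delta> \<le> 1" using c by (auto simp: \<delta>_def)
  have Lip: "Lip {0..1} f = 1" unfolding f_def by (rule Lip_min_abs[OF \<delta> order_refl])
  show "\<exists>I (f :: real \<Rightarrow> real). bounded_interval I \<and>
          (\<exists>C. C-lipschitz_on I f) \<and> (\<exists>t\<in>I. f t \<noteq> 0) \<and> Lip I f > 0 \<and>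
          (\<forall>I1 (g :: real \<Rightarrow> real).
            bounded_interval I1 \<and> I1 \<subseteq> I \<and> diameter I1 \<ge> c * diameter I \<and>
            affine_map_on I1 g \<and> Lip I1 g > Lip I f - ereal (1/4) \<longrightarrow>
            (SUP t\<in>I1. ereal \<bar>g t - f t\<bar>) \<ge> ereal (1/4 * diameter I1) * Lip I f)"
  proof (intro exI[of _ "{0..1}"] exI[of _ f] conjI allI impI)
    show "bounded_interval {0..1::real}"
      by (simp add: bounded_interval_def is_interval_cc interior_atLeastAtMost_real)
    show "\<exists>C. C-lipschitz_on {0..1} f" unfolding f_def using lipschitz_on_min_abs by blast
    show "\<exists>t\<in>{0..1}. f t \<noteq> 0" using \<delta> by (intro bexI[of _ 1]) (auto simp: f_def)
    show "0 < Lip {0..1} f" using Lip by simp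
    fix I1 and g :: "real \<Rightarrow> real"
    assume "bounded_interval I1 \<and> I1 \<subseteq> {0..1} \<and> diameter I1 \<ge> c * diameter {0..1::real} \<and>
      affine_map_on I1 g \<and> Lip I1 g > Lip {0..1} f - ereal (1/4)"
    then have "affine_map_on I1 g" "ereal (3/4) < Lip I1 g" "8 * \<delta> \<le> diameter I1"
      using Lip by (simp_all add: one_ereal_def \<delta>_def)
    then have "ereal (diameter I1 / 4) \<le> (SUP t\<in>I1. ereal \<bar>g t - f t\<bar>)"
      by (intro steep_affine_far_from_small[where \<delta> = \<delta>])
        (use \<delta>(1) in \<open>auto simp: f_def\<close>)
    then show "ereal (1/4 * diameter I1) * Lip {0..1} f \<le> (SUP t\<in>I1. ereal \<bar>g t - f t\<bar>)"
      using Lip by simp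
  qed
qed

end
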